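(* Let $n\ge m$ be positive integers, $A\in\mathbb{R}^{n\times n}$, $B\in\mathbb{R}^{n\times m}$, $\Phi$ a real symmetric $n\times n$ matrix with $\Phi>0$, $\gamma>0$ real, and let $M$ be a real symmetric $n\times n$ matrix satisfying the standing assumptions on $M$ listed in the context. Let $k\in\mathbb{N}$ and suppose that $\mathsf{dom}(\mathcal{S}_k)\ne\emptyset$. Then, for any $\phi\in\mathsf{dom}(\mathcal{S}_k)$, $$\mathcal{S}_k\phi=\widetilde{\mathcal{S}}_k\phi,$$ where $\mathcal{S}_k$ is the $k$-step dynamic programming evolution operator and $\widetilde{\mathcal{S}}_k$ is the max-plus integral operator with kernel $\mathrm{S}_k$, both defined in the context.
   Context: $\mathbb{N}=\{1,2,\dots\}$. $\mathbb{M}^{n\times n}$ denotes the real symmetric $n\times n$ matrices; $P>0$ ($P\ge0$) means positive (semi)definite, and $P>Q$ means $P-Q>0$. Riccati operator: $\mathcal{R}(P)=\Phi+A^TPA+A^TPB(\gamma^2I-B^TPB)^{-1}B^TPA$ for $P\in\mathbb{M}^{n\times n}$; $\mathcal{R}_0$ is the identity and $\mathcal{R}_{k+1}=\mathcal{R}\circ\mathcal{R}_k$. One says that $\mathcal{R}_k(P_0)$ exists if $\gamma^2I-B^T\mathcal{R}_i(P_0)B>0$ for $i=0,1,\dots,k-1$. Standing assumptions on $M\in\mathbb{M}^{n\times n}$: (i) $\gamma^2I-B^T\mathcal{R}_k(M)B>0$ for all integers $k\ge0$; (ii) $\mathcal{R}(M)-M>0$; (iii) $MB(\gamma^2I-B^TMB)^{-1}B^TM>0$.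 Dynamic programming evolution operators: $(\mathcal{S}\phi)(x)=\sup_{w\in\mathbb{R}^m}\{\frac12x^T\Phi x-\frac{\gamma^2}{2}|w|^2+\phi(Ax+Bw)\}$, $\mathcal{S}_0$ is the identity, and $\mathcal{S}_{k+1}\phi=\mathcal{S}(\mathcal{S}_k\phi)$. $\mathcal{Q}_+^{-M}(\mathbb{R}^n)$ is the set of functions $\phi:\mathbb{R}^n\to\mathbb{R}$ of the form $\phi(x)=\frac12x^T\Omega x$ with $\Omega\in\mathbb{M}^{n\times n}$, $\Omega>M$. $\mathsf{dom}(\mathcal{S}_k)$ is the set of $\phi\in\mathcal{Q}_+^{-M}(\mathbb{R}^n)$, $\phi(x)=\frac12x^T\Omega x$, such that $\mathcal{R}_k(\Omega)$ exists. $\psi(x,z)=\frac12(x-z)^TM(x-z)$ for $x,z\in\mathbb{R}^n$, and $(\mathcal{D}_\psi\phi)(z)=-\sup_{x\in\mathbb{R}^n}\{\psi(x,z)-\phi(x)\}$. Auxiliary value function: $\widehat{\mathrm{S}}_k(x,z)=(\mathcal{S}_k\psi(\cdot,z))(x)$. Kernel: for $k\in\mathbb{N}$, $\mathrm{S}_k(x,y)=(\mathcal{D}_\psi\widehat{\mathrm{S}}_k(x,\cdot))(y)=-\sup_{z\in\mathbb{R}^n}\{\psi(z,y)-\widehat{\mathrm{S}}_k(x,z)\}$. Under the assumptions on $M$ both functions are real-valued on $\mathbb{R}^n\times\mathbb{R}^n$. Max-plus integral operator: $(\widetilde{\mathcal{S}}_k\phi)(x)=\sup_{y\in\mathbb{R}^n}\{\mathrm{S}_k(x,y)+\phi(y)\}$,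 $x\in\mathbb{R}^n$. *)

theory Defs
  imports "HOL-Analysis.Analysis"
begin

definition sym_mat :: "real^'n^'n \<Rightarrow> bool" where
  "sym_mat P \<longleftrightarrow> transpose P = P"

definition pos_definite :: "real^'n^'n \<Rightarrow> bool" where
  "pos_definite P \<longleftrightarrow> sym_mat P \<and> (\<forall>x. x \<noteq> 0 \<longrightarrow> 0 < x \<bullet> (P *v x))"

definition gain_mat :: "real^'m^'n \<Rightarrow> real \<Rightarrow> real^'n^'n \<Rightarrow> real^'m^'m" where
  "gain_mat B \<gamma> P = mat (\<gamma>\<^sup>2) - transpose B ** P ** B"

text \<open>The Riccati operator. As \<open>matrix_inv\<close> is unspecified on singular matrices, its iterates are
  meaningful only under \<open>riccati_exists\<close> below.\<close>

definition riccati ::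
  "real^'n^'n \<Rightarrow> real^'m^'n \<Rightarrow> real^'n^'n \<Rightarrow> real \<Rightarrow> real^'n^'n \<Rightarrow> real^'n^'n" where
  "riccati A B \<Phi> \<gamma> P = \<Phi> + transpose A ** P ** A
     + transpose A ** P ** B ** matrix_inv (gain_mat B \<gamma> P) ** transpose B ** P ** A"

definition riccati_iter ::
  "real^'n^'n \<Rightarrow> real^'m^'n \<Rightarrow> real^'n^'n \<Rightarrow> real \<Rightarrow> nat \<Rightarrow> real^'n^'n \<Rightarrow> real^'n^'n" where
  "riccati_iter A B \<Phi> \<gamma> k = riccati A B \<Phi> \<gamma> ^^ k"

definition riccati_exists ::
  "real^'n^'n \<Rightarrow> real^'m^'n \<Rightarrow> real^'n^'n \<Rightarrow> real \<Rightarrow> nat \<Rightarrow> real^'n^'n \<Rightarrow> bool" where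
  "riccati_exists A B \<Phi> \<gamma> k P \<longleftrightarrow>
     (\<forall>i<k. pos_definite (gain_mat B \<gamma> (riccati_iter A B \<Phi> \<gamma> i P)))"

definition quad_form :: "real^'n^'n \<Rightarrow> real^'n \<Rightarrow> real" where
  "quad_form P x = 1/2 * (x \<bullet> (P *v x))"

definition quad_above :: "real^'n^'n \<Rightarrow> (real^'n \<Rightarrow> real) set" where
  "quad_above M = {quad_form \<Omega> | \<Omega>. sym_mat \<Omega> \<and> pos_definite (\<Omega> - M)}"

text \<open>All suprema are taken in the extended reals, since they need not be finite for
  arbitrary arguments.\<close>

definition dp_op ::
  "real^'n^'n \<Rightarrow> real^'m^'n \<Rightarrow> real^'n^'n \<Rightarrow> real \<Rightarrow> (real^'n \<Rightarrow> ereal) \<Rightarrow> real^'n \<Rightarrow> ereal" where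
  "dp_op A B \<Phi> \<gamma> \<phi> x =
     (SUP w. ereal (1/2 * (x \<bullet> (\<Phi> *v x)) - \<gamma>\<^sup>2 / 2 * (norm w)\<^sup>2) + \<phi> (A *v x + B *v w))"

definition dp_iter ::
  "real^'n^'n \<Rightarrow> real^'m^'n \<Rightarrow> real^'n^'n \<Rightarrow> real \<Rightarrow> nat \<Rightarrow> (real^'n \<Rightarrow> ereal) \<Rightarrow> real^'n \<Rightarrow> ereal" where
  "dp_iter A B \<Phi> \<gamma> k = dp_op A B \<Phi> \<gamma> ^^ k"

text \<open>The matrix of a quadratic form is required to be symmetric and is hence determined by the
  function \<open>\<phi>\<close>, so that the existential quantifier over \<open>\<Omega>\<close> is innocuous.\<close>

definition dp_dom ::
  "real^'n^'n \<Rightarrow> real^'m^'n \<Rightarrow> real^'n^'n \<Rightarrow> real \<Rightarrow> real^'n^'n \<Rightarrow> nat \<Rightarrow> (real^'n \<Rightarrow> real) set" where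
  "dp_dom A B \<Phi> \<gamma> M k =
     {\<phi> \<in> quad_above M. \<exists>\<Omega>. sym_mat \<Omega> \<and> \<phi> = quad_form \<Omega> \<and> riccati_exists A B \<Phi> \<gamma> k \<Omega>}"

definition psi :: "real^'n^'n \<Rightarrow> real^'n \<Rightarrow> real^'n \<Rightarrow> real" where
  "psi M x z = 1/2 * ((x - z) \<bullet> (M *v (x - z)))"

definition psi_dual :: "real^'n^'n \<Rightarrow> (real^'n \<Rightarrow> ereal) \<Rightarrow> real^'n \<Rightarrow> ereal" where
  "psi_dual M \<phi> z = - (SUP x. ereal (psi M x z) - \<phi> x)"

definition aux_value ::
  "real^'n^'n \<Rightarrow> real^'m^'n \<Rightarrow> real^'n^'n \<Rightarrow> real \<Rightarrow> real^'n^'n \<Rightarrow> nat \<Rightarrow> real^'n \<Rightarrow> real^'n \<Rightarrow> ereal" where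
  "aux_value A B \<Phi> \<gamma> M k x z = dp_iter A B \<Phi> \<gamma> k (\<lambda>\<xi>. ereal (psi M \<xi> z)) x"

definition maxplus_kernel ::
  "real^'n^'n \<Rightarrow> real^'m^'n \<Rightarrow> real^'n^'n \<Rightarrow> real \<Rightarrow> real^'n^'n \<Rightarrow> nat \<Rightarrow> real^'n \<Rightarrow> real^'n \<Rightarrow> ereal" where
  "maxplus_kernel A B \<Phi> \<gamma> M k x y = psi_dual M (\<lambda>z. aux_value A B \<Phi> \<gamma> M k x z) y"

text \<open>Isabelle sets \<open>\<infinity> + (-\<infinity>) = \<infinity>\<close> in the extended reals, unlike the max-plus convention. This sum
  does not arise when \<open>\<phi>\<close> is real-valued.\<close>

definition maxplus_op ::
  "real^'n^'n \<Rightarrow> real^'m^'n \<Rightarrow> real^'n^'n \<Rightarrow> real \<Rightarrow> real^'n^'n \<Rightarrow> nat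
    \<Rightarrow> (real^'n \<Rightarrow> ereal) \<Rightarrow> real^'n \<Rightarrow> ereal" where
  "maxplus_op A B \<Phi> \<gamma> M k \<phi> x = (SUP y. maxplus_kernel A B \<Phi> \<gamma> M k x y + \<phi> y)"

end

theory Submission
  imports Defs
begin

text \<open>
  The identity is a Galois-connection argument for suprema.

  For a fixed initial state \<open>x\<close>, every choice of a disturbance sequence contributes an accumulated
  running payoff \<open>c\<close> and a terminal state \<open>p\<close>, and the \<open>k\<close>-step value is the supremum of
  \<open>c + \<phi> p\<close> over all such pairs (\<open>dp_iter_eq_SUP_payoffs\<close>). The set of pairs does not depend
  on the terminal payoff \<open>\<phi>\<close>. Hence the auxiliary value function, read as a function of its
  second argument \<open>z\<close>, is a supremum of functions \<open>c + psi M p z\<close>, and such suprema are exactly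
  the ones recovered from their \<open>psi\<close>-dual: the dual at \<open>p\<close> is at least \<open>c\<close>. This gives
  the inequality from left to right.

  For the converse, the terminal payoff itself must be a supremum of functions
  \<open>b + psi M \<cdot> z\<close>. For a quadratic form with matrix \<open>\<Omega>\<close> this is semiconvexity: as \<open>\<Omega> - M\<close>
  is positive definite, a translate of the quadratic form of \<open>M\<close> that has the same gradient at a
  point touches from below there (\<open>quad_form_touched_by_psi\<close>). Such a translate exists because
  \<open>M\<close> is the rightmost factor of a positive definite product and hence invertible.
\<close>

primrec payoffs ::
  "real^'n^'n \<Rightarrow> real^'m^'n \<Rightarrow> real^'n^'n \<Rightarrow> real \<Rightarrow> nat \<Rightarrow> real^'n \<Rightarrow> (real \<times> (real^'n)) set" where
  "payoffs A B \<Phi> \<gamma> 0 x = {(0, x)}"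
| "payoffs A B \<Phi> \<gamma> (Suc k) x =
     (\<Union>w. (\<lambda>(c, p). (1/2 * (x \<bullet> (\<Phi> *v x)) - \<gamma>\<^sup>2 / 2 * (norm w)\<^sup>2 + c, p))
        ` payoffs A B \<Phi> \<gamma> k (A *v x + B *v w))"

lemma payoffs_nonempty: "payoffs A B \<Phi> \<gamma> k x \<noteq> {}"
  by (induction k arbitrary: x) auto

text \<open>Unrolling the recursion only needs that adding a finite running payoff commutes with a
  nonempty supremum, so the terminal payoff may take infinite values.\<close>

lemma dp_iter_eq_SUP_payoffs:
  "dp_iter A B \<Phi> \<gamma> k \<phi> x = (SUP (c, p)\<in>payoffs A B \<Phi> \<gamma> k x. ereal c + \<phi> p)"
proof (induction k arbitrary: x)
  case 0
  show ?case
    by (simp add: dp_iter_def zero_ereal_def[symmetric])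
next
  case (Suc k)
  let ?l = "\<lambda>w. 1/2 * (x \<bullet> (\<Phi> *v x)) - \<gamma>\<^sup>2 / 2 * (norm w)\<^sup>2"
  let ?T = "\<lambda>w. payoffs A B \<Phi> \<gamma> k (A *v x + B *v w)"
  have "dp_iter A B \<Phi> \<gamma> (Suc k) \<phi> x
      = (SUP w. ereal (?l w) + dp_iter A B \<Phi> \<gamma> k \<phi> (A *v x + B *v w))"
    by (simp add: dp_iter_def dp_op_def)
  also have "\<dots> = (SUP w. ereal (?l w) + (SUP (c, p)\<in>?T w. ereal c + \<phi> p))"
    by (simp only: Suc.IH)
  also have "\<dots> = (SUP w. SUP (c, p)\<in>?T w. ereal (?l w + c) + \<phi> p)"
  proof (rule SUP_cong[OF refl])
    fix w
    have "ereal (?l w) + (SUP (c, p)\<in>?T w. ereal c + \<phi> p)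
        = (SUP q\<in>?T w. ereal (?l w) + (case q of (c, p) \<Rightarrow> ereal c + \<phi> p))"
      by (rule SUP_ereal_add_right[symmetric]) (simp_all add: payoffs_nonempty)
    also have "\<dots> = (SUP (c, p)\<in>?T w. ereal (?l w + c) + \<phi> p)"
      by (rule SUP_cong[OF refl]) (auto simp: add.assoc[symmetric])
    finally show "ereal (?l w) + (SUP (c, p)\<in>?T w. ereal c + \<phi> p)
        = (SUP (c, p)\<in>?T w. ereal (?l w + c) + \<phi> p)" .
  qed
  also have "\<dots> = (SUP (c, p)\<in>payoffs A B \<Phi> \<gamma> (Suc k) x. ereal c + \<phi> p)"
    by (simp add: SUP_UNION image_image case_prod_beta)
  finally show ?case .
qed

lemma psi_commute: "psi M x z = psi M z x"
  by (simp add: psi_def matrix_vector_mult_diff_distrib inner_diff_left inner_diff_right)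

text \<open>A product that is positive definite is injective, hence so is its rightmost factor, which as a
  square matrix is then also surjective.\<close>

lemma surj_of_pos_definite_mult:
  fixes M N :: "real^'n^'n"
  assumes "pos_definite (N ** M)"
  shows "surj ((*v) M)"
proof -
  have "x = 0" if "M *v x = 0" for x
    using assms that
    by (metis inner_zero_right less_irrefl matrix_vector_mul_assoc matrix_vector_mult_0_right
        pos_definite_def)
  then have "inj ((*v) M)"
    using linear_injective_0[OF matrix_vector_mul_linear[of M]] by blast
  then show ?thesis
    by (rule linear_injective_imp_surjective[OF matrix_vector_mul_linear]) (rule refl)
qed

text \<open>With \<open>z\<close> chosen such that \<open>\<lambda>x. psi M x z\<close> has the gradient of the quadratic form at \<open>y\<close>,
  the gap between the two functions exceeds its value at \<open>y\<close> by the quadratic form of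
  \<open>\<Omega> - M\<close> at \<open>x - y\<close>.\<close>

lemma quad_form_touched_by_psi:
  assumes M: "sym_mat M" "surj ((*v) M)"
    and \<Omega>: "sym_mat \<Omega>" "pos_definite (\<Omega> - M)"
  obtains b z where "quad_form \<Omega> y = b + psi M y z"
    and "\<And>x. b + psi M x z \<le> quad_form \<Omega> x"
proof -
  from M(2) obtain u where u: "M *v u = \<Omega> *v y"
    by (metis surjD)
  let ?b = "quad_form \<Omega> y - psi M y (y - u)"
  have sym: "a \<bullet> (P *v c) = c \<bullet> (P *v a)" if "sym_mat P" for P :: "real^'n^'n" and a c
    using that by (metis dot_lmul_matrix inner_commute sym_mat_def transpose_matrix_vector)
  have "?b + psi M x (y - u) \<le> quad_form \<Omega> x" for x
  proof -
    define d where "d = x - y"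
    have x: "x = y + d" by (simp add: d_def)
    have "0 \<le> d \<bullet> ((\<Omega> - M) *v d)"
      using \<Omega>(2) by (cases "d = 0") (auto simp: pos_definite_def intro: less_imp_le)
    then have pos: "d \<bullet> (M *v d) \<le> d \<bullet> (\<Omega> *v d)"
      by (simp add: matrix_vector_mult_diff_rdistrib inner_diff_right)
    have "quad_form \<Omega> x = quad_form \<Omega> y + d \<bullet> (\<Omega> *v y) + 1/2 * (d \<bullet> (\<Omega> *v d))"
      using sym[OF \<Omega>(1), of y d]
      by (simp add: x quad_form_def matrix_vector_right_distrib inner_add_left inner_add_right)
    moreover have "psi M x (y - u) = psi M y (y - u) + d \<bullet> (M *v u) + 1/2 * (d \<bullet> (M *v d))"
      using sym[OF M(1), of u d]
      by (simp add: x psi_def matrix_vector_right_distrib inner_add_left inner_add_right)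
    ultimately show ?thesis
      using pos by (simp add: u)
  qed
  then show thesis
    using that[of ?b "y - u"] by simp
qed

text \<open>The max-plus integral formula in its abstract form: \<open>T\<close> is the set of payoff and terminal
  state pairs seen from one initial state, \<open>g\<close> is the auxiliary value function there, and its
  \<open>psi\<close>-dual is the kernel.\<close>

lemma SUP_eq_SUP_psi_dual:
  fixes T :: "(real \<times> (real^'n)) set" and \<phi> :: "real^'n \<Rightarrow> real"
  assumes T: "T \<noteq> {}"
    and touched: "\<And>y. \<exists>b z. \<phi> y = b + psi M y z \<and> (\<forall>x. b + psi M x z \<le> \<phi> x)"
    and g: "\<And>z. g z = (SUP (c, p)\<in>T. ereal c + ereal (psi M p z))"
  shows "(SUP (c, p)\<in>T. ereal c + ereal (\<phi> p)) = (SUP y. psi_dual M g y + ereal (\<phi> y))"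
proof (rule antisym)
  show "(SUP (c, p)\<in>T. ereal c + ereal (\<phi> p)) \<le> (SUP y. psi_dual M g y + ereal (\<phi> y))"
  proof (rule SUP_least, clarify)
    fix c p assume cp: "(c, p) \<in> T"
    have "ereal (psi M z p) - g z \<le> ereal (- c)" for z
    proof -
      have "ereal c + ereal (psi M p z) \<le> g z"
        unfolding g by (rule SUP_upper2[OF cp]) simp
      then show ?thesis
        by (cases "g z") (auto simp: psi_commute)
    qed
    then have "(SUP z. ereal (psi M z p) - g z) \<le> ereal (- c)"
      by (rule SUP_least)
    then have "ereal c \<le> psi_dual M g p"
      unfolding psi_dual_def by (metis ereal_minus_le_minus ereal_uminus_uminus uminus_ereal.simps(1))
    then have "ereal c + ereal (\<phi> p) \<le> psi_dual M g p + ereal (\<phi> p)"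
      by (rule add_right_mono)
    also have "\<dots> \<le> (SUP y. psi_dual M g y + ereal (\<phi> y))"
      by (rule SUP_upper) simp
    finally show "ereal c + ereal (\<phi> p) \<le> (SUP y. psi_dual M g y + ereal (\<phi> y))" .
  qed
next
  show "(SUP y. psi_dual M g y + ereal (\<phi> y)) \<le> (SUP (c, p)\<in>T. ereal c + ereal (\<phi> p))"
  proof (rule SUP_least)
    fix y
    obtain b z where y: "\<phi> y = b + psi M y z" and below: "\<And>x. b + psi M x z \<le> \<phi> x"
      using touched by blast
    have "psi_dual M g y \<le> - (ereal (psi M z y) - g z)"
      unfolding psi_dual_def ereal_minus_le_minus by (rule SUP_upper) simp
    \<comment> \<open>The two \<open>psi\<close> terms cancel by symmetry.\<close>
    then have "psi_dual M g y + ereal (\<phi> y) \<le> ereal b + g z"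
      unfolding y psi_commute[of M y z]
      by (cases "g z"; cases "psi_dual M g y") auto
    also have "\<dots> = (SUP q\<in>T. ereal b + (case q of (c, p) \<Rightarrow> ereal c + ereal (psi M p z)))"
      unfolding g by (rule SUP_ereal_add_right[symmetric]) (use T in auto)
    also have "\<dots> \<le> (SUP (c, p)\<in>T. ereal c + ereal (\<phi> p))"
    proof (rule SUP_mono')
      show "ereal b + (case q of (c, p) \<Rightarrow> ereal c + ereal (psi M p z))
          \<le> (case q of (c, p) \<Rightarrow> ereal c + ereal (\<phi> p))" for q
        using below[of "snd q"] by (cases q) simp
    qed
    finally show "psi_dual M g y + ereal (\<phi> y) \<le> (SUP (c, p)\<in>T. ereal c + ereal (\<phi> p))" .
  qed
qed

theorem theorem5p1:
  fixes A :: "real^'n^'n" and B :: "real^'m^'n" and \<Phi> M :: "real^'n^'n"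
    and \<gamma> :: real and k :: nat and \<phi> :: "real^'n \<Rightarrow> real"
  assumes "CARD('m) \<le> CARD('n)"
    and "sym_mat \<Phi>" and "pos_definite \<Phi>"
    and "0 < \<gamma>"
    and "sym_mat M"
    and "\<And>j. pos_definite (gain_mat B \<gamma> (riccati_iter A B \<Phi> \<gamma> j M))"
    and "pos_definite (riccati A B \<Phi> \<gamma> M - M)"
    and "pos_definite (M ** B ** matrix_inv (gain_mat B \<gamma> M) ** transpose B ** M)"
    and "1 \<le> k"
    and "dp_dom A B \<Phi> \<gamma> M k \<noteq> {}"
    and "\<phi> \<in> dp_dom A B \<Phi> \<gamma> M k"
  shows "dp_iter A B \<Phi> \<gamma> k (\<lambda>x. ereal (\<phi> x)) = maxplus_op A B \<Phi> \<gamma> M k (\<lambda>x. ereal (\<phi> x))"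
proof
  fix x
  obtain \<Omega> where \<phi>: "\<phi> = quad_form \<Omega>" and \<Omega>: "sym_mat \<Omega>" "pos_definite (\<Omega> - M)"
    using assms(11) by (auto simp: dp_dom_def quad_above_def)
  have "surj ((*v) M)"
    using assms(8) by (rule surj_of_pos_definite_mult)
  then have touched: "\<exists>b z. \<phi> y = b + psi M y z \<and> (\<forall>x. b + psi M x z \<le> \<phi> x)" for y
    unfolding \<phi> using quad_form_touched_by_psi[OF assms(5) _ \<Omega>] by metis
  show "dp_iter A B \<Phi> \<gamma> k (\<lambda>x. ereal (\<phi> x)) x
      = maxplus_op A B \<Phi> \<gamma> M k (\<lambda>x. ereal (\<phi> x)) x"
    unfolding maxplus_op_def maxplus_kernel_def dp_iter_eq_SUP_payoffs
    by (rule SUP_eq_SUP_psi_dual[OF payoffs_nonempty touched])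
      (simp_all add: aux_value_def dp_iter_eq_SUP_payoffs)
qed

end
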